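(* Let $\lambda>0$, $\eta_1>1$, $\eta_2>0$, and $p,q>0$ with $p+q=1$. For every $t>0$, the function $H(t,\cdot)$ defined in the context satisfies $$H(t,x)=\frac{1}{2\sqrt{\pi}}(\eta_1\lambda tp)^{\frac14}\exp\left\{\frac{\eta_2\lambda tq}{\eta_1+\eta_2}-\lambda t\right\}(\log x)^{-\frac34}\exp\left\{2\sqrt{\eta_1\lambda tp}\sqrt{\log x}\right\}x^{-\eta_1-1}\left(1+O\left((\log x)^{-\frac12}\right)\right)$$ as $x\to\infty$, and $$H(t,x)=\frac{1}{2\sqrt{\pi}}(\eta_2\lambda tq)^{\frac14}\exp\left\{\frac{\eta_1\lambda tp}{\eta_1+\eta_2}-\lambda t\right\}\left(\log\frac1x\right)^{-\frac34}\exp\left\{2\sqrt{\eta_2\lambda tq}\sqrt{\log\frac1x}\right\}x^{\eta_2-1}\left(1+O\left(\left(\log\frac1x\right)^{-\frac12}\right)\right)$$ as $x\to0$.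
   Context: Let $N$ be a Poisson process with intensity $\lambda$ and let $U_1,U_2,\dots$ be i.i.d. random variables, independent of $N$, with double exponential density $g(u)=p\eta_1e^{-\eta_1u}\chi_{\{u\ge0\}}+q\eta_2e^{\eta_2u}\chi_{\{u<0\}}$. Put $X^{(2)}_t=\exp\{\sum_{i=1}^{N_t}U_i\}$. The distribution $\mu_t^{(2)}$ of $X_t^{(2)}$ has the form $d\mu^{(2)}_t(x)=e^{-\lambda t}d\delta_1(x)+H(t,x)dx$, $x>0$, where $$H(t,x)=H_1(t,x)x^{-\eta_1-1}\chi_{\{x>1\}}+H_2(t,x)x^{\eta_2-1}\chi_{\{0<x<1\}},$$ $H_1(t,x)=\sum_{k\ge0}a_k(\log x)^k$ for $x>1$, and $H_2(t,x)=\sum_{k\ge0}b_k(\log\frac1x)^k$ for $0<x<1$. Here, with $\pi_n=e^{-\lambda t}(\lambda t)^n/n!$, $$a_k=\frac{\eta_1^{k+1}}{k!}\sum_{n=k+1}^\infty\pi_nP_{n,k+1},\qquad b_k=\frac{\eta_2^{k+1}}{k!}\sum_{n=k+1}^\infty\pi_nQ_{n,k+1},$$ where for $1\le k\le n-1$ $$P_{n,k}=\sum_{i=k}^{n-1}\binom{n-k-1}{i-k}\binom{n}{i}\left(\frac{\eta_1}{\eta_1+\eta_2}\right)^{i-k}\left(\frac{\eta_2}{\eta_1+\eta_2}\right)^{n-i}p^iq^{n-i},$$ $$Q_{n,k}=\sum_{i=k}^{n-1}\binom{n-k-1}{i-k}\binom{n}{i}\left(\frac{\eta_1}{\eta_1+\eta_2}\right)^{n-i}\left(\frac{\eta_2}{\eta_1+\eta_2}\right)^{i-k}p^{n-i}q^i,$$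 and $P_{n,n}=p^n$, $Q_{n,n}=q^n$. *)

theory Defs
  imports Complex_Main "HOL-Library.Landau_Symbols"
begin

text \<open>
  The parameters are always listed in the order \<open>lam\<close> (jump intensity), \<open>\<eta>1\<close>, \<open>\<eta>2\<close>
  (rates of the upward and downward exponential jumps of the log-price), \<open>p\<close>, \<open>q\<close>
  (probabilities of an upward and a downward jump), \<open>t\<close> (time), as far as they are needed.
\<close>

definition poisson_weight :: "real \<Rightarrow> real \<Rightarrow> nat \<Rightarrow> real" where
  "poisson_weight lam t n = exp (- lam * t) * (lam * t) ^ n / fact n"

text \<open>
  The next two functions are used only for \<open>1 \<le> k \<le> n\<close>, so the
  subtractions on natural numbers below never truncate.
\<close>

definition P_coeff :: "real \<Rightarrow> real \<Rightarrow> real \<Rightarrow> real \<Rightarrow> nat \<Rightarrow> nat \<Rightarrow> real" where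
  "P_coeff \<eta>1 \<eta>2 p q n k =
     (if k = n then p ^ n
      else \<Sum>i = k..n - 1. real ((n - k - 1) choose (i - k)) * real (n choose i)
             * (\<eta>1 / (\<eta>1 + \<eta>2)) ^ (i - k) * (\<eta>2 / (\<eta>1 + \<eta>2)) ^ (n - i)
             * p ^ i * q ^ (n - i))"

definition Q_coeff :: "real \<Rightarrow> real \<Rightarrow> real \<Rightarrow> real \<Rightarrow> nat \<Rightarrow> nat \<Rightarrow> real" where
  "Q_coeff \<eta>1 \<eta>2 p q n k =
     (if k = n then q ^ n
      else \<Sum>i = k..n - 1. real ((n - k - 1) choose (i - k)) * real (n choose i)
             * (\<eta>1 / (\<eta>1 + \<eta>2)) ^ (n - i) * (\<eta>2 / (\<eta>1 + \<eta>2)) ^ (i - k)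
             * p ^ (n - i) * q ^ i)"

text \<open>
  The series over \<open>n \<ge> k + 1\<close> are written with the index shift \<open>n = m + k + 1\<close>.
\<close>

definition a_coeff :: "real \<Rightarrow> real \<Rightarrow> real \<Rightarrow> real \<Rightarrow> real \<Rightarrow> real \<Rightarrow> nat \<Rightarrow> real" where
  "a_coeff lam \<eta>1 \<eta>2 p q t k =
     \<eta>1 ^ (k + 1) / fact k *
     (\<Sum>m. poisson_weight lam t (m + k + 1) * P_coeff \<eta>1 \<eta>2 p q (m + k + 1) (k + 1))"

definition b_coeff :: "real \<Rightarrow> real \<Rightarrow> real \<Rightarrow> real \<Rightarrow> real \<Rightarrow> real \<Rightarrow> nat \<Rightarrow> real" where
  "b_coeff lam \<eta>1 \<eta>2 p q t k =
     \<eta>2 ^ (k + 1) / fact k *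
     (\<Sum>m. poisson_weight lam t (m + k + 1) * Q_coeff \<eta>1 \<eta>2 p q (m + k + 1) (k + 1))"

definition H1 :: "real \<Rightarrow> real \<Rightarrow> real \<Rightarrow> real \<Rightarrow> real \<Rightarrow> real \<Rightarrow> real \<Rightarrow> real" where
  "H1 lam \<eta>1 \<eta>2 p q t x = (\<Sum>k. a_coeff lam \<eta>1 \<eta>2 p q t k * ln x ^ k)"

definition H2 :: "real \<Rightarrow> real \<Rightarrow> real \<Rightarrow> real \<Rightarrow> real \<Rightarrow> real \<Rightarrow> real \<Rightarrow> real" where
  "H2 lam \<eta>1 \<eta>2 p q t x = (\<Sum>k. b_coeff lam \<eta>1 \<eta>2 p q t k * ln (1 / x) ^ k)"

text \<open>
  Density of the absolutely continuous part of the law of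
  \<open>exp (U\<^sub>1 + \<dots> + U\<^bsub>N\<^esub>)\<close>, where \<open>N\<close> is Poisson distributed with mean \<open>lam t\<close> and the
  \<open>U\<^sub>i\<close> are i.i.d. double exponential, independent of \<open>N\<close>.
\<close>

definition H :: "real \<Rightarrow> real \<Rightarrow> real \<Rightarrow> real \<Rightarrow> real \<Rightarrow> real \<Rightarrow> real \<Rightarrow> real" where
  "H lam \<eta>1 \<eta>2 p q t x =
     (if x > 1 then H1 lam \<eta>1 \<eta>2 p q t x * x powr (- \<eta>1 - 1) else 0) +
     (if 0 < x \<and> x < 1 then H2 lam \<eta>1 \<eta>2 p q t x * x powr (\<eta>2 - 1) else 0)"

end

theory Submission
  imports Defs "HOL-Analysis.Analysis"
begin

text \<open>
  Write \<open>c = \<eta>1 lam t p\<close>. In the double sum defining \<open>a\<^sub>k\<close> the terms with \<open>i = k + 1\<close> add up to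
  an exponential series, and all other terms together are smaller by a factor \<open>O(1 / k)\<close>. Hence
  \<open>a\<^sub>k = const * c ^ (k + 1) / (k! (k + 1)!) * (1 + O(1 / k))\<close>, and \<open>H1\<close> at \<open>x = exp y\<close> is a
  perturbation of the Bessel series \<open>\<Sum>k. z ^ k / (k! (k + 1)!)\<close> at \<open>z = c y\<close>. By Poisson's integral
  the latter equals \<open>2 / pi\<close> times the integral of \<open>exp (2 sqrt z u) sqrt (1 - u\<^sup>2)\<close> over \<open>[-1, 1]\<close>, to which
  Laplace's method applies at the endpoint \<open>u = 1\<close>. The perturbation costs a relative error
  \<open>O(1 / sqrt z)\<close>, as the terms with \<open>k\<close> of order \<open>sqrt z\<close> dominate. The behaviour
  at \<open>0\<close> follows by exchanging the roles of upward and downward jumps.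
\<close>

section \<open>Poisson's integral for the Bessel series\<close>

text \<open>Closed form of the moment of order \<open>2 * k\<close> of the weight
  \<open>sqrt (1 - u\<^sup>2)\<close> on \<open>[-1, 1]\<close>: \<open>pi / 2\<close> times the
  Catalan number, divided by \<open>4 ^ k\<close>.\<close>

definition semicircle_moment :: "nat \<Rightarrow> real" where
  "semicircle_moment k = pi / 2 * fact (2 * k) / (4 ^ k * (fact k * fact (Suc k)))"

lemma semicircle_moment_Suc:
  "semicircle_moment (Suc k) = real (2 * k + 1) * semicircle_moment k / real (2 * k + 4)"
proof -
  have 1: "fact (2 * Suc k) = 2 * (real k + 1) * real (2 * k + 1) * fact (2 * k)"
    and 2: "fact (Suc (Suc k)) = (real k + 2) * (real k + 1) * fact k"
    and 3: "fact (Suc k) = (real k + 1) * fact k"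
    and 4: "real (2 * k + 4) = 2 * (real k + 2)"
    by (simp_all add: algebra_simps)
  have *: "pi / 2 * (2 * y * w * f) / (4 * a * (y * g * (z * y * g)))
      = w * (pi / 2 * f / (a * (g * (y * g)))) / (2 * z)"
    if "y > 0" "z > 0" "f > 0" "g > 0" "a > 0" for y z w f g a :: real
    using that by (simp add: mult_ac)
  show ?thesis unfolding semicircle_moment_def 1 2 3 4 power_Suc by (rule *) simp_all
qed

lemma has_integral_semicircle: "((\<lambda>u. sqrt (1 - u\<^sup>2)) has_integral pi / 2) {-1..1::real}"
proof -
  have "((\<lambda>u. sqrt (1 - u\<^sup>2)) has_integral
      ((1 * sqrt (1 - 1\<^sup>2) + arcsin 1) / 2 - (- 1 * sqrt (1 - (- 1)\<^sup>2) + arcsin (- 1)) / 2)) {-1..1::real}"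
  \<comment> \<open>Derivatives are taken in the open interval only: neither
    \<open>sqrt (1 - u\<^sup>2)\<close> nor \<open>arcsin u\<close> is differentiable at the
    endpoints.\<close>
  proof (rule fundamental_theorem_of_calculus_interior)
    show "continuous_on {-1..1} (\<lambda>u::real. (u * sqrt (1 - u\<^sup>2) + arcsin u) / 2)"
      by (intro continuous_intros) auto
    fix u :: real assume u: "u \<in> {-1<..<1}"
    then have pos: "0 < 1 - u\<^sup>2"
      by (simp add: abs_square_less_1 abs_less_iff)
    have "((\<lambda>u. (u * sqrt (1 - u\<^sup>2) + arcsin u) / 2) has_real_derivative
        (sqrt (1 - u\<^sup>2) - u\<^sup>2 / sqrt (1 - u\<^sup>2) + 1 / sqrt (1 - u\<^sup>2)) / 2) (at u)"
      using u pos
      by (auto intro!: derivative_eq_intros simp: field_simps power2_eq_square)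
    also have "(sqrt (1 - u\<^sup>2) - u\<^sup>2 / sqrt (1 - u\<^sup>2) + 1 / sqrt (1 - u\<^sup>2)) / 2 = sqrt (1 - u\<^sup>2)"
      using pos by (simp add: field_simps)
    finally show "((\<lambda>u. (u * sqrt (1 - u\<^sup>2) + arcsin u) / 2) has_vector_derivative sqrt (1 - u\<^sup>2)) (at u)"
      by (simp add: has_real_derivative_iff_has_vector_derivative)
  qed auto
  then show ?thesis by simp
qed

text \<open>Integration by parts: \<open>u ^ (2 * k + 1) * (1 - u\<^sup>2) powr (3 / 2)\<close>
  vanishes at both endpoints, and its derivative combines two consecutive moments. The resulting
  recursion is that of the closed form.\<close>

lemma has_integral_semicircle_moment:
  "((\<lambda>u. u ^ (2 * k) * sqrt (1 - u\<^sup>2)) has_integral semicircle_moment k) {-1..1::real}"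
proof (induction k)
  case 0
  then show ?case using has_integral_semicircle by (simp add: semicircle_moment_def)
next
  case (Suc k)
  let ?F = "\<lambda>u::real. u ^ (2 * k + 1) * ((1 - u\<^sup>2) * sqrt (1 - u\<^sup>2))"
  let ?f = "\<lambda>u::real. (2 * k + 1) * (u ^ (2 * k) * sqrt (1 - u\<^sup>2))
                   - (2 * k + 4) * (u ^ (2 * Suc k) * sqrt (1 - u\<^sup>2))"
  have "(?f has_integral (?F 1 - ?F (-1))) {-1..1}"
  proof (rule fundamental_theorem_of_calculus_interior)
    show "continuous_on {-1..1} ?F" by (intro continuous_intros)
    fix u :: real assume u: "u \<in> {-1<..<1}"
    then have pos: "0 < 1 - u\<^sup>2"
      by (simp add: abs_square_less_1 abs_less_iff)
    have "((\<lambda>u. (1 - u\<^sup>2) * sqrt (1 - u\<^sup>2)) has_real_derivative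
        - 2 * u * sqrt (1 - u\<^sup>2) - (1 - u\<^sup>2) * (u / sqrt (1 - u\<^sup>2))) (at u)"
      using pos by (auto intro!: derivative_eq_intros simp: field_simps)
    also have "(1 - u\<^sup>2) * (u / sqrt (1 - u\<^sup>2)) = u * sqrt (1 - u\<^sup>2)"
      using pos by (simp add: field_simps)
    finally have "((\<lambda>u. (1 - u\<^sup>2) * sqrt (1 - u\<^sup>2)) has_real_derivative - 3 * u * sqrt (1 - u\<^sup>2)) (at u)"
      by (simp add: mult.assoc)
    from DERIV_mult[OF DERIV_pow[of "2 * k + 1"] this]
    have "(?F has_real_derivative (2 * k + 1) * u ^ (2 * k) * ((1 - u\<^sup>2) * sqrt (1 - u\<^sup>2))
        + - 3 * u * sqrt (1 - u\<^sup>2) * u ^ (2 * k + 1)) (at u)"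
      by simp
    also have "(2 * k + 1) * u ^ (2 * k) * ((1 - u\<^sup>2) * sqrt (1 - u\<^sup>2))
        + - 3 * u * sqrt (1 - u\<^sup>2) * u ^ (2 * k + 1) = ?f u"
      by (simp add: algebra_simps power2_eq_square)
    finally show "(?F has_vector_derivative ?f u) (at u)"
      by (simp add: has_real_derivative_iff_has_vector_derivative)
  qed auto
  then have "(?f has_integral 0) {-1..1}" by simp
  from has_integral_diff[OF has_integral_mult_right[OF Suc, of "real (2 * k + 1)"] this]
  have "((\<lambda>u. real (2 * k + 4) * (u ^ (2 * Suc k) * sqrt (1 - u\<^sup>2))) has_integral
      real (2 * k + 1) * semicircle_moment k) {-1..1}"
    by (simp del: power_Suc mult_Suc_right)
  from has_integral_mult_right[OF this, of "1 / real (2 * k + 4)"]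
  have "((\<lambda>u. u ^ (2 * Suc k) * sqrt (1 - u\<^sup>2)) has_integral
      real (2 * k + 1) * semicircle_moment k / real (2 * k + 4)) {-1..1}"
    by (simp del: power_Suc mult_Suc_right of_nat_add of_nat_mult)
  also have "real (2 * k + 1) * semicircle_moment k / real (2 * k + 4) = semicircle_moment (Suc k)"
    by (rule semicircle_moment_Suc[symmetric])
  finally show ?case .
qed

lemma sums_cosh_even: "(\<lambda>k. x ^ (2 * k) / fact (2 * k)) sums cosh (x::real)"
proof -
  have "strict_mono (\<lambda>k::nat. 2 * k)" by (auto intro: strict_monoI)
  then have "(\<lambda>k. if even (2 * k) then x ^ (2 * k) /\<^sub>R fact (2 * k) else 0) sums cosh x"
    by (subst sums_mono_reindex[where f = "\<lambda>n. if even n then x ^ n /\<^sub>R fact n else 0"])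
      (use cosh_converges in \<open>auto elim!: evenE\<close>)
  then show ?thesis by (simp add: divide_inverse mult.commute)
qed

text \<open>Termwise integration of the \<open>cosh\<close> series. The factor
  \<open>fact (2 * k)\<close> of the moment cancels the one of \<open>cosh\<close>, which leaves the
  Bessel coefficients.\<close>

lemma sums_cosh_semicircle:
  fixes s :: real
  shows "(\<lambda>k. (s / 2) ^ (2 * k) / (fact k * fact (Suc k))) sums
     (2 / pi * integral {-1..1} (\<lambda>u. cosh (s * u) * sqrt (1 - u\<^sup>2)))"
proof -
  let ?f = "\<lambda>k u. (s * u) ^ (2 * k) / fact (2 * k) * sqrt (1 - u\<^sup>2)"
  \<comment> \<open>On \<open>[-1, 1]\<close> both \<open>u ^ (2 * k)\<close> and the square root
    are at most 1, so the series of \<open>cosh s\<close> is a majorant. Uniform convergence permits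
    exchanging sum and integral.\<close>
  have lim: "uniform_limit {-1..1} (\<lambda>n u. \<Sum>k<n. ?f k u) (\<lambda>u. \<Sum>k. ?f k u) sequentially"
  proof (rule Weierstrass_m_test)
    show "summable (\<lambda>k. s ^ (2 * k) / fact (2 * k))"
      using sums_cosh_even sums_summable by blast
    fix k and u :: real assume u: "u \<in> {-1..1}"
    then have "u\<^sup>2 \<le> 1" by (simp add: abs_square_le_1 abs_le_iff)
    then have "(u\<^sup>2) ^ k * sqrt (1 - u\<^sup>2) \<le> 1 * 1"
      by (intro mult_mono power_le_one[of "u\<^sup>2"]) auto
    then have "(s ^ (2 * k) / fact (2 * k)) * (u ^ (2 * k) * sqrt (1 - u\<^sup>2)) \<le> (s ^ (2 * k) / fact (2 * k)) * 1"
      by (intro mult_left_mono) (auto simp: power_mult)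
    then show "norm (?f k u) \<le> s ^ (2 * k) / fact (2 * k)"
      using \<open>u\<^sup>2 \<le> 1\<close> by (simp add: power_mult_distrib abs_mult power_mult)
  qed
  have "(\<Sum>k. ?f k u) = cosh (s * u) * sqrt (1 - u\<^sup>2)" for u
    using sums_mult2[OF sums_cosh_even[of "s * u"], of "sqrt (1 - u\<^sup>2)"] by (rule sums_unique[symmetric])
  with lim have lim: "uniform_limit {-1..1} (\<lambda>n u. \<Sum>k<n. ?f k u) (\<lambda>u. cosh (s * u) * sqrt (1 - u\<^sup>2)) sequentially"
    by simp
  obtain I J where I: "\<And>n. ((\<lambda>u. \<Sum>k<n. ?f k u) has_integral I n) {-1..1}"
    and J: "((\<lambda>u. cosh (s * u) * sqrt (1 - u\<^sup>2)) has_integral J) {-1..1}"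
    and IJ: "I \<longlonglongrightarrow> J"
    by (rule uniform_limit_integral[OF lim]) (auto intro!: continuous_intros)
  have "((\<lambda>u. \<Sum>k<n. ?f k u) has_integral (\<Sum>k<n. s ^ (2 * k) / fact (2 * k) * semicircle_moment k)) {-1..1}" for n
  proof (rule has_integral_sum)
    fix k
    show "(?f k has_integral s ^ (2 * k) / fact (2 * k) * semicircle_moment k) {-1..1}"
      using has_integral_mult_right[OF has_integral_semicircle_moment, of "s ^ (2 * k) / fact (2 * k)" k]
      by (simp add: power_mult_distrib mult.assoc)
  qed auto
  then have "I = (\<lambda>n. \<Sum>k<n. s ^ (2 * k) / fact (2 * k) * semicircle_moment k)"
    using I has_integral_unique by blast
  with IJ have "(\<lambda>k. s ^ (2 * k) / fact (2 * k) * semicircle_moment k) sums J"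
    by (simp add: sums_def)
  from sums_mult[OF this, of "2 / pi"]
  have "(\<lambda>k. 2 / pi * (s ^ (2 * k) / fact (2 * k) * semicircle_moment k)) sums (2 / pi * J)" .
  also have "(\<lambda>k. 2 / pi * (s ^ (2 * k) / fact (2 * k) * semicircle_moment k))
      = (\<lambda>k. (s / 2) ^ (2 * k) / (fact k * fact (Suc k)))"
    by (rule ext) (simp add: semicircle_moment_def power_divide power_mult del: fact_Suc)
  finally show ?thesis
    using integral_unique[OF J] by simp
qed

text \<open>The weight is even, so the odd part of \<open>exp (s * u)\<close> integrates to zero.
  With \<open>exp\<close> in place of \<open>cosh\<close>, only the endpoint \<open>u = 1\<close>
  matters for large \<open>s\<close>.\<close>

lemma integral_cosh_semicircle:
  fixes s :: real
  shows "integral {-1..1} (\<lambda>u. cosh (s * u) * sqrt (1 - u\<^sup>2))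
    = integral {-1..1} (\<lambda>u. exp (s * u) * sqrt (1 - u\<^sup>2))"
proof -
  let ?I = "integral {-1..1} (\<lambda>u. exp (s * u) * sqrt (1 - u\<^sup>2))"
  have I: "((\<lambda>u. exp (s * u) * sqrt (1 - u\<^sup>2)) has_integral ?I) {-1..1}"
    by (intro integrable_integral integrable_continuous_real continuous_intros)
  then have "((\<lambda>u. exp (s * (- u)) * sqrt (1 - (- u)\<^sup>2)) has_integral ?I) {-1..1}"
    using has_integral_reflect_lemma_real[OF I] unfolding minus_minus by blast
  from has_integral_mult_right[OF has_integral_add[OF I this], of "1 / 2"]
  have "((\<lambda>u. 1 / 2 * (exp (s * u) * sqrt (1 - u\<^sup>2) + exp (s * - u) * sqrt (1 - (- u)\<^sup>2)))
      has_integral 1 / 2 * (?I + ?I)) {-1..1}" .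
  also have "(\<lambda>u. 1 / 2 * (exp (s * u) * sqrt (1 - u\<^sup>2) + exp (s * - u) * sqrt (1 - (- u)\<^sup>2)))
      = (\<lambda>u. cosh (s * u) * sqrt (1 - u\<^sup>2))"
    by (rule ext) (simp add: cosh_def distrib_right)
  finally have "integral {-1..1} (\<lambda>u. cosh (s * u) * sqrt (1 - u\<^sup>2)) = 1 / 2 * (?I + ?I)"
    by (rule integral_unique)
  also have "\<dots> = ?I"
    unfolding mult_2[symmetric] by simp
  finally show ?thesis .
qed

section \<open>Laplace's method with an explicit error\<close>

lemma Gamma_3_2: "Gamma (3 / 2 :: real) = sqrt pi / 2"
  using Gamma_plus1[of "1 / 2 :: real"] nonpos_Ints_nonpos[of "1 / 2 :: real"]
  by (auto simp: Gamma_one_half_real)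

lemma Gamma_5_2: "Gamma (5 / 2 :: real) = 3 * sqrt pi / 4"
  using Gamma_plus1[of "3 / 2 :: real"] nonpos_Ints_nonpos[of "3 / 2 :: real"]
  by (auto simp: Gamma_3_2)

text \<open>
  Extending \<open>sqrt (2 - v)\<close> by zero keeps the linear bound valid beyond \<open>v = 2\<close>, so the integral can be
  compared with Gamma integrals over the whole half line and no tail has to be estimated.
\<close>

lemma abs_sqrt_two_minus_le:
  fixes v :: real
  assumes "0 \<le> v"
  shows "\<bar>(if v \<le> 2 then sqrt (2 - v) else 0) - sqrt 2\<bar> \<le> v / sqrt 2"
proof (cases "v \<le> 2")
  case True
  let ?d = "sqrt 2 - sqrt (2 - v)"
  have "?d \<ge> 0" using assms True by simp
  then have "?d * sqrt 2 \<le> ?d * (sqrt 2 + sqrt (2 - v))"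
    using True by (intro mult_left_mono) auto
  also have "\<dots> = v"
    using True assms by (simp add: algebra_simps)
  finally show ?thesis
    using \<open>?d \<ge> 0\<close> True by (simp add: field_simps)
next
  case False
  then show ?thesis by (simp add: field_simps)
qed

text \<open>Substituting \<open>u = 1 - w / s\<close> turns the integrand into
  \<open>exp (- w) * sqrt w * sqrt (2 - w / s)\<close>, up to normalisation. Replacing the last root
  by \<open>sqrt 2\<close> gives \<open>Gamma (3 / 2)\<close>; the linear error bound adds a factor
  \<open>w\<close> and gives \<open>Gamma (5 / 2)\<close>. The ratio of the two contributions is
  \<open>3 / (4 * s)\<close>.\<close>

lemma integral_exp_semicircle_asymp:
  fixes s :: real
  assumes s: "0 < s"
  defines "J \<equiv> integral {-1..1} (\<lambda>u. exp (s * u) * sqrt (1 - u\<^sup>2))"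
    and "M \<equiv> exp s * sqrt (pi / 2) / (s * sqrt s)"
  shows "\<bar>J - M\<bar> \<le> 3 / (4 * s) * M"
proof -
  let ?f = "\<lambda>w. exp (- w) * sqrt w * (if w / s \<le> 2 then sqrt (2 - w / s) else 0)"
  have "((\<lambda>u. exp (s * u) * sqrt (1 - u\<^sup>2)) has_integral J) {-1..1}"
    unfolding J_def by (intro integrable_integral integrable_continuous_real continuous_intros)
  from has_integral_reflect_lemma_real[OF this]
  have "((\<lambda>u. exp (s * - u) * sqrt (1 - (- u)\<^sup>2)) has_integral J) (cbox (-1) 1)"
    unfolding minus_minus cbox_interval .
  \<comment> \<open>The endpoint \<open>u = 1\<close> was reflected to \<open>-1\<close>, which now
    corresponds to \<open>w = 0\<close>.\<close>
  from has_integral_affinity'[OF this, of "1 / s" "-1"] s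
  have "((\<lambda>w. exp (s * - (w / s - 1)) * sqrt (1 - (w / s - 1)\<^sup>2)) has_integral (s * J)) {0..2 * s}"
    by (simp add: field_simps)
  from has_integral_mult_right[OF this, of "exp (- s) * sqrt s"]
  have "((\<lambda>w. exp (- s) * sqrt s * (exp (s * - (w / s - 1)) * sqrt (1 - (w / s - 1)\<^sup>2)))
      has_integral (exp (- s) * sqrt s * (s * J))) {0..2 * s}" .
  moreover have "exp (- s) * sqrt s * (exp (s * - (w / s - 1)) * sqrt (1 - (w / s - 1)\<^sup>2)) = ?f w"
    if "w \<in> {0..2 * s}" for w
  proof -
    have "s * - (w / s - 1) = s - w" using s by (simp add: field_simps)
    then have E: "exp (- s) * exp (s * - (w / s - 1)) = exp (- w)"
      by (simp add: exp_add[symmetric])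
    have "s * (1 - (w / s - 1)\<^sup>2) = w * (2 - w / s)"
      using s by (simp add: field_simps power2_eq_square)
    then have R: "sqrt s * sqrt (1 - (w / s - 1)\<^sup>2) = sqrt w * sqrt (2 - w / s)"
      by (simp only: real_sqrt_mult[symmetric])
    have "exp (- s) * sqrt s * (exp (s * - (w / s - 1)) * sqrt (1 - (w / s - 1)\<^sup>2))
        = (exp (- s) * exp (s * - (w / s - 1))) * (sqrt s * sqrt (1 - (w / s - 1)\<^sup>2))"
      by (simp only: mult_ac)
    also have "\<dots> = exp (- w) * (sqrt w * sqrt (2 - w / s))"
      by (simp only: E R)
    finally show ?thesis
      using that s by (simp add: field_simps)
  qed
  ultimately have "(?f has_integral (exp (- s) * sqrt s * (s * J))) {0..2 * s}"
    by (rule has_integral_eq[rotated])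
  then have "((\<lambda>w. if w \<in> {0..2 * s} then ?f w else 0) has_integral (exp (- s) * sqrt s * (s * J))) {0..}"
    by (subst has_integral_restrict) auto
  then have "(?f has_integral (exp (- s) * sqrt s * (s * J))) {0..}"
    by (rule has_integral_eq[rotated]) (use s in \<open>auto simp: field_simps\<close>)
  moreover have "((\<lambda>w. sqrt 2 * (w powr (3 / 2 - 1) / exp w)) has_integral (sqrt 2 * Gamma (3 / 2))) {0..}"
    by (intro has_integral_mult_right Gamma_integral_real) simp
  ultimately have diff: "((\<lambda>w. ?f w - sqrt 2 * (w powr (3 / 2 - 1) / exp w)) has_integral
      (exp (- s) * sqrt s * (s * J) - sqrt 2 * Gamma (3 / 2))) {0..}"
    by (rule has_integral_diff)
  have bound: "((\<lambda>w. 1 / (s * sqrt 2) * (w powr (5 / 2 - 1) / exp w)) has_integral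
      (1 / (s * sqrt 2) * Gamma (5 / 2))) {0..}"
    by (intro has_integral_mult_right Gamma_integral_real) simp
  have "norm (exp (- s) * sqrt s * (s * J) - sqrt 2 * Gamma (3 / 2))
      \<le> (1 / (s * sqrt 2) * Gamma (5 / 2)) \<bullet> 1"
  proof (rule has_integral_norm_bound_integral_component[OF diff bound])
    fix w :: real assume "w \<in> {0..}"
    then have w: "0 \<le> w" by simp
    have "w powr (3 / 2) = w powr (1 + 1 / 2)" by simp
    also have "\<dots> = w * sqrt w"
      using w unfolding powr_add by (simp add: powr_half_sqrt)
    finally have p: "w powr (3 / 2) = w * sqrt w" .
    have "?f w - sqrt 2 * (w powr (3 / 2 - 1) / exp w)
        = exp (- w) * sqrt w * ((if w / s \<le> 2 then sqrt (2 - w / s) else 0) - sqrt 2)"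
      using w by (simp add: powr_half_sqrt exp_minus field_simps)
    also have "norm \<dots> \<le> exp (- w) * sqrt w * (w / s / sqrt 2)"
      unfolding norm_mult[of "exp (- w) * sqrt w"]
    proof (rule mult_mono)
      show "norm ((if w / s \<le> 2 then sqrt (2 - w / s) else 0) - sqrt 2) \<le> w / s / sqrt 2"
        unfolding real_norm_def using w s by (intro abs_sqrt_two_minus_le) simp
    qed (use w in \<open>auto simp: norm_mult\<close>)
    also have "\<dots> = (1 / (s * sqrt 2) * (w powr (5 / 2 - 1) / exp w)) \<bullet> 1"
      using p by (simp add: exp_minus field_simps)
    finally show "norm (?f w - sqrt 2 * (w powr (3 / 2 - 1) / exp w))
        \<le> (1 / (s * sqrt 2) * (w powr (5 / 2 - 1) / exp w)) \<bullet> 1" .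
  qed
  then have le: "\<bar>exp (- s) * sqrt s * (s * J) - sqrt 2 * (sqrt pi / 2)\<bar> \<le> 3 * sqrt pi / 4 / (s * sqrt 2)"
    by (simp add: Gamma_3_2 Gamma_5_2)
  \<comment> \<open>\<open>N\<close> is the reciprocal of the normalising factor
    \<open>exp (- s) * sqrt s * s\<close>.\<close>
  define N where "N = exp s / (s * sqrt s)"
  have "N > 0" using s by (simp add: N_def)
  have NJ: "N * (exp (- s) * sqrt s * (s * J)) = J"
    using s by (simp add: N_def exp_minus)
  have sqrt_half: "sqrt (pi / 2) = sqrt 2 * (sqrt pi / 2)"
    by (simp add: real_sqrt_divide field_simps)
  have NM: "N * (sqrt 2 * (sqrt pi / 2)) = M"
    unfolding M_def N_def sqrt_half by simp
  have "\<bar>J - M\<bar> = N * \<bar>exp (- s) * sqrt s * (s * J) - sqrt 2 * (sqrt pi / 2)\<bar>"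
    using \<open>N > 0\<close> NJ NM by (metis abs_mult abs_of_pos right_diff_distrib)
  also have "\<dots> \<le> N * (3 * sqrt pi / 4 / (s * sqrt 2))"
    using le \<open>N > 0\<close> by (intro mult_left_mono) auto
  also have "\<dots> = 3 / (4 * s) * M"
    unfolding NM[symmetric] using s by (simp add: field_simps)
  finally show ?thesis .
qed

section \<open>Asymptotics and perturbation of the Bessel series\<close>

text \<open>In terms of the modified Bessel function, this is \<open>I\<^sub>1 (2 * sqrt z) / sqrt z\<close>.\<close>

definition bessel_series :: "real \<Rightarrow> real" where
  "bessel_series z = (\<Sum>k. z ^ k / (fact k * fact (Suc k)))"

text \<open>Leading term of \<open>bessel_series\<close> at infinity, from
  \<open>exp s / sqrt (2 * pi * s)\<close> for the Bessel function at
  \<open>s = 2 * sqrt z\<close>.\<close>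

definition bessel_main :: "real \<Rightarrow> real" where
  "bessel_main z = 1 / (2 * sqrt pi) * z powr (- 3 / 4) * exp (2 * sqrt z)"

lemma bessel_series_sums:
  assumes "0 < z"
  shows "(\<lambda>k. z ^ k / (fact k * fact (Suc k))) sums bessel_series z"
    and bessel_series_eq_integral:
      "bessel_series z = 2 / pi * integral {-1..1} (\<lambda>u. exp (2 * sqrt z * u) * sqrt (1 - u\<^sup>2))"
proof -
  have "(2 * sqrt z / 2) ^ (2 * k) = z ^ k" for k
    using assms by (simp add: power_mult)
  then have "(\<lambda>k. z ^ k / (fact k * fact (Suc k))) sums
      (2 / pi * integral {-1..1} (\<lambda>u. exp (2 * sqrt z * u) * sqrt (1 - u\<^sup>2)))"
    using sums_cosh_semicircle[of "2 * sqrt z"] unfolding integral_cosh_semicircle by (simp only:)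
  then show "(\<lambda>k. z ^ k / (fact k * fact (Suc k))) sums bessel_series z"
    and "bessel_series z = 2 / pi * integral {-1..1} (\<lambda>u. exp (2 * sqrt z * u) * sqrt (1 - u\<^sup>2))"
    unfolding bessel_series_def by (auto simp only: sums_iff)
qed

lemma bessel_main_pos: "0 < z \<Longrightarrow> 0 < bessel_main z"
  by (simp add: bessel_main_def)

text \<open>The Laplace estimate at \<open>s = 2 * sqrt z\<close>; the factor \<open>2 / pi\<close>
  of Poisson's integral turns \<open>M\<close> into \<open>bessel_main z\<close>.\<close>

lemma bessel_series_asymp:
  assumes z: "0 < z"
  shows "\<bar>bessel_series z - bessel_main z\<bar> \<le> 3 / (8 * sqrt z) * bessel_main z"
proof -
  define s where "s = 2 * sqrt z"
  define M where "M = exp s * sqrt (pi / 2) / (s * sqrt s)"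
  have s: "0 < s" using z by (simp add: s_def)
  have "z powr (3 / 4) = z powr (1 / 2 + 1 / 4)" by simp
  also have "\<dots> = z powr (1 / 2) * (z powr (1 / 2)) powr (1 / 2)"
    unfolding powr_add powr_powr by simp
  also have "\<dots> = sqrt z * sqrt (sqrt z)"
    using z by (simp add: powr_half_sqrt)
  finally have "z powr (3 / 4) = sqrt z * sqrt (sqrt z)" .
  then have p: "z powr (- 3 / 4) = 1 / (sqrt z * sqrt (sqrt z))"
    using powr_minus_divide[of z "3 / 4"] by simp
  have "2 / pi * M = 2 * sqrt pi / (pi * 4) * (exp s / (sqrt z * sqrt (sqrt z)))"
    unfolding M_def by (simp add: s_def real_sqrt_divide real_sqrt_mult field_simps)
  also have "2 * sqrt pi / (pi * 4) = 1 / (2 * sqrt pi)"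
    by (simp add: field_simps)
  finally have M: "2 / pi * M = bessel_main z"
    unfolding bessel_main_def p s_def by simp
  have "bessel_series z - bessel_main z
      = 2 / pi * (integral {-1..1} (\<lambda>u. exp (s * u) * sqrt (1 - u\<^sup>2)) - M)"
    unfolding bessel_series_eq_integral[OF z] M[symmetric] s_def by (simp only: right_diff_distrib)
  then have "\<bar>bessel_series z - bessel_main z\<bar>
      = 2 / pi * \<bar>integral {-1..1} (\<lambda>u. exp (s * u) * sqrt (1 - u\<^sup>2)) - M\<bar>"
    by (simp only: abs_mult) simp
  also have "\<dots> \<le> 2 / pi * (3 / (4 * s) * M)"
    using integral_exp_semicircle_asymp[OF s] by (intro mult_left_mono) (simp_all add: M_def)
  also have "\<dots> = 3 / (4 * s) * (2 / pi * M)"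
    by (simp only: mult_ac)
  finally show ?thesis
    unfolding M by (simp add: s_def)
qed

text \<open>Converts a relative error of order \<open>1 / k\<close> in the coefficients into one of
  order \<open>1 / sqrt z\<close> in the sum. Comparing each term with its neighbour avoids having
  to locate the dominant range of \<open>k\<close>.\<close>

lemma bessel_series_shifted_bound:
  assumes z: "0 < z"
  shows "summable (\<lambda>k. z ^ k / (fact k * fact (Suc k)) / real (k + 2))"
    and "(\<Sum>k. z ^ k / (fact k * fact (Suc k)) / real (k + 2)) \<le> bessel_series z / sqrt z"
proof -
  define x where "x k = z ^ k / (fact k * fact (Suc k))" for k
  have x_pos: "0 < x k" for k using z by (simp add: x_def)
  have x_Suc: "x (Suc k) = x k * (z / (real (k + 1) * real (k + 2)))" for k
    unfolding x_def by (simp add: field_simps)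
  have x: "x sums bessel_series z"
    unfolding x_def by (rule bessel_series_sums[OF z])
  then have x': "(\<lambda>k. x (Suc k)) sums (bessel_series z - x 0)"
    by (subst sums_Suc_iff) simp
  \<comment> \<open>AM-GM: \<open>sqrt z\<close> times the term is at most the geometric mean of two neighbours.\<close>
  have le: "x k / real (k + 2) \<le> 1 / (2 * sqrt z) * (x k + x (Suc k))" for k
  proof -
    define r where "r = sqrt z"
    have r: "0 < r" "z = r\<^sup>2" using z by (auto simp: r_def)
    have "2 * r / real (k + 2) \<le> 1 + (r / real (k + 2))\<^sup>2"
      using zero_le_power2[of "1 - r / real (k + 2)"] by (simp add: power2_diff)
    also have "(r / real (k + 2))\<^sup>2 \<le> z / (real (k + 1) * real (k + 2))"
      unfolding r power2_eq_square times_divide_times_eq by (intro divide_left_mono mult_right_mono) auto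
    finally have "2 * r / real (k + 2) \<le> 1 + z / (real (k + 1) * real (k + 2))" by simp
    then have "x k * (2 * r / real (k + 2)) \<le> x k * (1 + z / (real (k + 1) * real (k + 2)))"
      using x_pos[of k] by (intro mult_left_mono) auto
    then have "x k * (2 * r / real (k + 2)) \<le> x k + x (Suc k)"
      unfolding x_Suc by (simp add: distrib_left)
    then show ?thesis
      unfolding r_def[symmetric] using r by (simp add: field_simps)
  qed
  have sm: "summable (\<lambda>k. x k / real (k + 2))"
  proof (rule summable_comparison_test'[OF sums_summable[OF x]])
    fix k
    show "norm (x k / real (k + 2)) \<le> x k"
      using x_pos[of k] by (simp add: field_simps)
  qed
  have "(\<Sum>k. x k / real (k + 2)) \<le> 1 / (2 * sqrt z) * (bessel_series z + (bessel_series z - x 0))"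
    using sums_mult[OF sums_add[OF x x'], of "1 / (2 * sqrt z)"] sm le
    by (intro sums_le[OF _ summable_sums]) auto
  also have "\<dots> \<le> 1 / (2 * sqrt z) * (bessel_series z + bessel_series z)"
    using x_pos[of 0] z by (intro mult_left_mono) auto
  finally show "(\<Sum>k. z ^ k / (fact k * fact (Suc k)) / real (k + 2)) \<le> bessel_series z / sqrt z"
    and "summable (\<lambda>k. z ^ k / (fact k * fact (Suc k)) / real (k + 2))"
    using sm by (simp_all add: x_def)
qed

text \<open>Since the perturbation is nonnegative, the lower bound is immediate; the upper one
  applies the preceding estimate to the sum of the perturbations.\<close>

lemma perturbed_bessel_series_bounds:
  assumes z: "0 < z" and C: "0 \<le> C"
    and \<delta>: "\<And>k. 0 \<le> \<delta> k \<and> \<delta> k \<le> C / real (k + 2)"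
  shows "bessel_series z \<le> (\<Sum>k. z ^ k / (fact k * fact (Suc k)) * (1 + \<delta> k))"
    and "(\<Sum>k. z ^ k / (fact k * fact (Suc k)) * (1 + \<delta> k)) \<le> bessel_series z * (1 + C / sqrt z)"
    and "summable (\<lambda>k. z ^ k / (fact k * fact (Suc k)) * (1 + \<delta> k))"
proof -
  define x where "x k = z ^ k / (fact k * fact (Suc k))" for k
  have x_pos: "0 \<le> x k" for k using z by (simp add: x_def)
  have x: "x sums bessel_series z"
    unfolding x_def by (rule bessel_series_sums[OF z])
  have sm2: "summable (\<lambda>k. x k / real (k + 2))"
    and le2: "(\<Sum>k. x k / real (k + 2)) \<le> bessel_series z / sqrt z"
    using bessel_series_shifted_bound[OF z] by (simp_all only: x_def)
  have le: "0 \<le> x k * \<delta> k \<and> x k * \<delta> k \<le> C * (x k / real (k + 2))" for k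
    using \<delta>[of k] x_pos[of k] mult_left_mono[of "\<delta> k" "C / real (k + 2)" "x k"] by (auto simp: mult_ac)
  have sm\<delta>: "summable (\<lambda>k. x k * \<delta> k)"
    by (rule summable_comparison_test'[OF summable_mult[OF sm2, of C]]) (use le in auto)
  have "(\<Sum>k. x k * \<delta> k) \<le> (\<Sum>k. C * (x k / real (k + 2)))"
    using le by (intro suminf_le sm\<delta> summable_mult sm2) auto
  also have "\<dots> = C * (\<Sum>k. x k / real (k + 2))"
    by (rule suminf_mult[OF sm2])
  also have "\<dots> \<le> C * (bessel_series z / sqrt z)"
    using le2 C by (rule mult_left_mono)
  finally have upper: "(\<Sum>k. x k * \<delta> k) \<le> C * (bessel_series z / sqrt z)" .
  have lower: "0 \<le> (\<Sum>k. x k * \<delta> k)"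
    using le by (intro suminf_nonneg sm\<delta>) auto
  have s: "(\<lambda>k. x k * (1 + \<delta> k)) sums (bessel_series z + (\<Sum>k. x k * \<delta> k))"
    using sums_add[OF x summable_sums[OF sm\<delta>]] by (simp add: distrib_left)
  show "bessel_series z \<le> (\<Sum>k. z ^ k / (fact k * fact (Suc k)) * (1 + \<delta> k))"
    and "(\<Sum>k. z ^ k / (fact k * fact (Suc k)) * (1 + \<delta> k)) \<le> bessel_series z * (1 + C / sqrt z)"
    and "summable (\<lambda>k. z ^ k / (fact k * fact (Suc k)) * (1 + \<delta> k))"
    unfolding x_def[symmetric] using s upper lower by (auto simp: sums_iff algebra_simps)
qed

section \<open>Asymptotics of the coefficients\<close>

text \<open>Source of the gain \<open>1 / (K + 1)\<close>: for \<open>l \<ge> 1\<close> the binomial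
  coefficient \<open>(l + K) choose l\<close> is at least its value \<open>K + 1\<close> at
  \<open>l = 1\<close>.\<close>

lemma fact_mult_fact_le:
  assumes "1 \<le> l"
  shows "real (Suc K) * fact l * fact K \<le> (fact (l + K) :: real)"
  using assms
proof (induction l rule: dec_induct)
  case base
  then show ?case by simp
next
  case (step l)
  have "real (Suc K) * fact (Suc l) * fact K = real (Suc l) * (real (Suc K) * fact l * fact K)"
    by (simp only: fact_Suc mult_ac)
  also have "\<dots> \<le> real (Suc (l + K)) * fact (l + K)"
    using step.IH by (intro mult_mono) auto
  finally show ?case by simp
qed

text \<open>Normalised contribution of the indices \<open>i = K + l\<close> with \<open>l > 0\<close> to \<open>P\<^bsub>m+K,K\<^esub>\<close>.\<close>

definition cross_term :: "real \<Rightarrow> real \<Rightarrow> nat \<Rightarrow> nat \<Rightarrow> real" where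
  "cross_term A B K m = (\<Sum>l\<in>{1..<m}. real ((m - 1) choose l) * A ^ l * B ^ (m - l) / fact (m - l)
     * (fact K / fact (l + K)))"

text \<open>With \<open>i = l + K\<close>, the factorial of the Poisson weight cancels the numerator
  of \<open>(m + K) choose (l + K)\<close>, and all powers sort into \<open>A\<close>,
  \<open>B\<close> and \<open>lam * t * p\<close>.\<close>

lemma poisson_weight_P_coeff:
  fixes lam \<eta>1 \<eta>2 p q t :: real
  defines "A \<equiv> lam * t * p * (\<eta>1 / (\<eta>1 + \<eta>2))" and "B \<equiv> lam * t * q * (\<eta>2 / (\<eta>1 + \<eta>2))"
  shows "poisson_weight lam t (m + K) * P_coeff \<eta>1 \<eta>2 p q (m + K) K
    = exp (- lam * t) * (lam * t * p) ^ K / fact K * (B ^ m / fact m + cross_term A B K m)"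
\<comment> \<open>Here \<open>P_coeff\<close> takes its diagonal value \<open>p ^ K\<close>, which
  matches \<open>B ^ 0 / fact 0 = 1\<close> and an empty \<open>cross_term\<close>.\<close>
proof (cases "m = 0")
  case True
  then show ?thesis
    by (simp add: P_coeff_def poisson_weight_def cross_term_def power_mult_distrib)
next
  case False
  define \<alpha> \<beta> where "\<alpha> = \<eta>1 / (\<eta>1 + \<eta>2)" and "\<beta> = \<eta>2 / (\<eta>1 + \<eta>2)"
  have AB: "A = lam * t * p * \<alpha>" "B = lam * t * q * \<beta>"
    by (simp_all add: A_def B_def \<alpha>_def \<beta>_def)
  let ?w = "poisson_weight lam t (m + K)" and ?c = "exp (- lam * t) * (lam * t * p) ^ K / fact K"
  let ?g = "\<lambda>l. real ((m - 1) choose l) * A ^ l * B ^ (m - l) / fact (m - l) * (fact K / fact (l + K))"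
  have "P_coeff \<eta>1 \<eta>2 p q (m + K) K = (\<Sum>i = 0 + K..(m - 1) + K. real ((m + K - K - 1) choose (i - K))
      * real ((m + K) choose i) * \<alpha> ^ (i - K) * \<beta> ^ (m + K - i) * p ^ i * q ^ (m + K - i))"
    using False by (simp add: P_coeff_def \<alpha>_def \<beta>_def)
  also have "\<dots> = (\<Sum>l = 0..m - 1. real ((m - 1) choose l)
      * real ((m + K) choose (l + K)) * \<alpha> ^ l * \<beta> ^ (m - l) * p ^ (l + K) * q ^ (m - l))"
    unfolding sum.shift_bounds_cl_nat_ivl by simp
  finally have P: "P_coeff \<eta>1 \<eta>2 p q (m + K) K = (\<Sum>l = 0..m - 1. real ((m - 1) choose l)
      * real ((m + K) choose (l + K)) * \<alpha> ^ l * \<beta> ^ (m - l) * p ^ (l + K) * q ^ (m - l))" .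
  have "?w * P_coeff \<eta>1 \<eta>2 p q (m + K) K = (\<Sum>l = 0..m - 1. ?c * ?g l)"
    unfolding P sum_distrib_left
  proof (rule sum.cong)
    fix l assume "l \<in> {0..m - 1}"
    with False have l: "l < m" by auto
    then have split: "(lam * t) ^ (m + K) = (lam * t) ^ K * (lam * t) ^ l * (lam * t) ^ (m - l)"
      by (simp add: power_add[symmetric] add.commute)
    have "real ((m + K) choose (l + K)) = fact (m + K) / (fact (l + K) * fact (m - l))"
      using l by (subst binomial_fact) auto
    then have w: "?w * real ((m + K) choose (l + K)) = exp (- lam * t) * (lam * t) ^ (m + K) / (fact (l + K) * fact (m - l))"
      by (simp add: poisson_weight_def)
    have "?w * (real ((m - 1) choose l) * real ((m + K) choose (l + K)) * \<alpha> ^ l * \<beta> ^ (m - l) * p ^ (l + K) * q ^ (m - l))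
      = ?w * real ((m + K) choose (l + K)) * (real ((m - 1) choose l) * \<alpha> ^ l * \<beta> ^ (m - l) * p ^ (l + K) * q ^ (m - l))"
      by (simp only: mult_ac)
    also have "\<dots> = exp (- lam * t) * (lam * t) ^ (m + K) / (fact (l + K) * fact (m - l))
        * (real ((m - 1) choose l) * \<alpha> ^ l * \<beta> ^ (m - l) * p ^ (l + K) * q ^ (m - l))"
      unfolding w ..
    also have "\<dots> = ?c * ?g l"
      unfolding AB split by (simp add: power_mult_distrib power_add mult_ac)
    finally show "?w * (real ((m - 1) choose l) * real ((m + K) choose (l + K)) * \<alpha> ^ l * \<beta> ^ (m - l) * p ^ (l + K) * q ^ (m - l))
      = ?c * ?g l" .
  qed simp
  also have "\<dots> = ?c * sum ?g {0..m - 1}"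
    by (rule sum_distrib_left[symmetric])
  \<comment> \<open>The index \<open>l = 0\<close> is split off: it produces the exponential series
    in \<open>B\<close>.\<close>
  also have "sum ?g {0..m - 1} = sum ?g (insert 0 {1..<m})"
    using False by (intro sum.cong) auto
  also have "\<dots> = B ^ m / fact m + cross_term A B K m"
    by (subst sum.insert) (simp_all add: cross_term_def)
  finally show ?thesis .
qed

text \<open>The bound \<open>2 ^ m\<close> for the first binomial coefficient is crude, but only
  summability in \<open>m\<close>, uniformly in \<open>K\<close>, matters. The remaining factorials
  form \<open>m choose l\<close>, so the binomial theorem applies.\<close>

lemma cross_term_bounds:
  fixes A B :: real
  assumes A: "0 \<le> A" and B: "0 \<le> B"
  shows "0 \<le> cross_term A B K m"
    and "cross_term A B K m \<le> 1 / real (Suc K) * ((2 * (A + B)) ^ m / fact m)"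
proof -
  show "0 \<le> cross_term A B K m"
    unfolding cross_term_def using assms by (intro sum_nonneg) auto
  have "cross_term A B K m \<le> (\<Sum>l\<in>{1..<m}. 2 ^ m / (real (Suc K) * fact m) * (real (m choose l) * A ^ l * B ^ (m - l)))"
    unfolding cross_term_def
  proof (rule sum_mono)
    fix l assume "l \<in> {1..<m}"
    then have l: "1 \<le> l" "l < m" by auto
    have "(m - 1) choose l \<le> 2 ^ (m - 1)" by (rule binomial_le_pow2)
    also have "\<dots> \<le> 2 ^ m" by (intro power_increasing) auto
    finally have 1: "real ((m - 1) choose l) \<le> 2 ^ m"
      by (metis of_nat_le_iff of_nat_numeral of_nat_power)
    have 2: "fact K / fact (l + K) \<le> 1 / (real (Suc K) * fact l)"
      using fact_mult_fact_le[OF l(1), of K] by (simp add: field_simps del: fact_Suc of_nat_Suc)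
    have 3: "real (m choose l) / fact m = 1 / (fact l * fact (m - l))"
      using l by (subst binomial_fact) auto
    have "real ((m - 1) choose l) * A ^ l * B ^ (m - l) / fact (m - l) * (fact K / fact (l + K))
        = A ^ l * B ^ (m - l) / fact (m - l) * (real ((m - 1) choose l) * (fact K / fact (l + K)))"
      by simp
    also have "\<dots> \<le> A ^ l * B ^ (m - l) / fact (m - l) * (2 ^ m * (1 / (real (Suc K) * fact l)))"
      using A B 1 2 by (intro mult_left_mono mult_mono) auto
    also have "\<dots> = 2 ^ m / real (Suc K) * (1 / (fact l * fact (m - l))) * A ^ l * B ^ (m - l)"
      by (simp add: mult_ac)
    also have "\<dots> = 2 ^ m / (real (Suc K) * fact m) * (real (m choose l) * A ^ l * B ^ (m - l))"
      unfolding 3[symmetric] by simp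
    finally show "real ((m - 1) choose l) * A ^ l * B ^ (m - l) / fact (m - l) * (fact K / fact (l + K))
      \<le> 2 ^ m / (real (Suc K) * fact m) * (real (m choose l) * A ^ l * B ^ (m - l))" .
  qed
  \<comment> \<open>The nonnegative terms \<open>l = 0\<close> and \<open>l = m\<close> complete the
    binomial expansion.\<close>
  also have "\<dots> \<le> (\<Sum>l\<le>m. 2 ^ m / (real (Suc K) * fact m) * (real (m choose l) * A ^ l * B ^ (m - l)))"
    using A B by (intro sum_mono2) auto
  also have "\<dots> = 2 ^ m / (real (Suc K) * fact m) * (A + B) ^ m"
    unfolding binomial_ring sum_distrib_left ..
  also have "\<dots> = 1 / real (Suc K) * ((2 * (A + B)) ^ m / fact m)"
    unfolding power_mult_distrib[of 2] by simp
  finally show "cross_term A B K m \<le> 1 / real (Suc K) * ((2 * (A + B)) ^ m / fact m)" .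
qed

lemma exp_sums: "(\<lambda>n. x ^ n / fact n) sums exp (x::real)"
  using exp_converges[of x] by (simp add: divide_inverse mult.commute)

text \<open>Summing over \<open>m\<close> at \<open>K = k + 1\<close>, the \<open>l = 0\<close>
  terms give \<open>exp B\<close>, and \<open>\<delta> k\<close> is the total of the cross terms
  relative to it. The denominator \<open>k + 2\<close> is \<open>K + 1\<close>.\<close>

lemma a_coeff_estimate:
  fixes lam \<eta>1 \<eta>2 p q t :: real
  assumes "0 < lam" "0 < \<eta>1" "0 < \<eta>2" "0 < p" "0 < q" "0 < t"
  obtains C \<delta> where "0 \<le> C" and "\<And>k. 0 \<le> \<delta> k \<and> \<delta> k \<le> C / real (k + 2)"
    and "\<And>k. a_coeff lam \<eta>1 \<eta>2 p q t k = exp (\<eta>2 * lam * t * q / (\<eta>1 + \<eta>2) - lam * t)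
          * (\<eta>1 * lam * t * p) ^ Suc k / (fact k * fact (Suc k)) * (1 + \<delta> k)"
proof
  define A B where "A = lam * t * p * (\<eta>1 / (\<eta>1 + \<eta>2))" and "B = lam * t * q * (\<eta>2 / (\<eta>1 + \<eta>2))"
  have AB: "0 \<le> A" "0 \<le> B" using assms by (simp_all add: A_def B_def)
  define \<delta> where "\<delta> k = suminf (cross_term A B (Suc k)) / exp B" for k
  show "0 \<le> exp (2 * (A + B)) / exp B" by simp
  have exp_S: "(\<lambda>m. 1 / real (Suc K) * ((2 * (A + B)) ^ m / fact m)) sums (1 / real (Suc K) * exp (2 * (A + B)))" for K
    by (intro sums_mult exp_sums)
  have cross: "summable (cross_term A B K)" for K
    by (rule summable_comparison_test'[OF sums_summable[OF exp_S]])
      (use cross_term_bounds[OF AB] in auto)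
  fix k
  have "0 \<le> suminf (cross_term A B (Suc k))"
    by (intro suminf_nonneg cross cross_term_bounds AB)
  moreover have "suminf (cross_term A B (Suc k)) \<le> 1 / real (Suc (Suc k)) * exp (2 * (A + B))"
    by (rule sums_le[OF _ summable_sums[OF cross] exp_S]) (rule cross_term_bounds[OF AB])
  ultimately show "0 \<le> \<delta> k \<and> \<delta> k \<le> exp (2 * (A + B)) / exp B / real (k + 2)"
    by (simp add: \<delta>_def divide_simps)
  let ?c = "exp (- lam * t) * (lam * t * p) ^ Suc k / fact (Suc k)"
  have "(\<lambda>m. ?c * (B ^ m / fact m + cross_term A B (Suc k) m)) sums (?c * (exp B + suminf (cross_term A B (Suc k))))"
    by (intro sums_mult sums_add exp_sums summable_sums cross)
  also have "exp B + suminf (cross_term A B (Suc k)) = exp B * (1 + \<delta> k)"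
    by (simp add: \<delta>_def field_simps)
  finally have "(\<Sum>m. poisson_weight lam t (m + k + 1) * P_coeff \<eta>1 \<eta>2 p q (m + k + 1) (k + 1))
      = ?c * (exp B * (1 + \<delta> k))"
    using poisson_weight_P_coeff[of lam t _ "Suc k" \<eta>1 \<eta>2 p q] unfolding A_def B_def
    by (simp add: sums_iff del: power_Suc fact_Suc)
  then have "a_coeff lam \<eta>1 \<eta>2 p q t k = \<eta>1 ^ Suc k / fact k * (?c * (exp B * (1 + \<delta> k)))"
    unfolding a_coeff_def by simp
  also have "\<dots> = exp (- lam * t) * exp B * (\<eta>1 * lam * t * p) ^ Suc k / (fact k * fact (Suc k)) * (1 + \<delta> k)"
    by (simp add: power_mult_distrib del: power_Suc fact_Suc)
  also have "exp (- lam * t) * exp B = exp (\<eta>2 * lam * t * q / (\<eta>1 + \<eta>2) - lam * t)"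
    unfolding exp_add[symmetric] B_def by (simp add: mult_ac)
  finally show "a_coeff lam \<eta>1 \<eta>2 p q t k = exp (\<eta>2 * lam * t * q / (\<eta>1 + \<eta>2) - lam * t)
      * (\<eta>1 * lam * t * p) ^ Suc k / (fact k * fact (Suc k)) * (1 + \<delta> k)" .
qed

section \<open>From the coefficients to the density\<close>

text \<open>Formulated in \<open>y\<close>, so that it serves both for \<open>y = ln x\<close> at
  infinity and, with exchanged parameters, for \<open>y = ln (1 / x)\<close> at 0.\<close>

lemma a_coeff_series_asymp:
  fixes lam \<eta>1 \<eta>2 p q t :: real
  assumes pos: "0 < lam" "0 < \<eta>1" "0 < \<eta>2" "0 < p" "0 < q" "0 < t"
  defines "main \<equiv> \<lambda>y. 1 / (2 * sqrt pi) * (\<eta>1 * lam * t * p) powr (1 / 4)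
    * exp (\<eta>2 * lam * t * q / (\<eta>1 + \<eta>2) - lam * t) * y powr (- 3 / 4)
    * exp (2 * sqrt (\<eta>1 * lam * t * p) * sqrt y)"
  shows "\<exists>D. \<forall>y\<ge>1.
    \<bar>(\<Sum>k. a_coeff lam \<eta>1 \<eta>2 p q t k * y ^ k) - main y\<bar> \<le> D * y powr (- 1 / 2) * main y"
proof -
  define c where "c = \<eta>1 * lam * t * p"
  define W where "W = exp (\<eta>2 * lam * t * q / (\<eta>1 + \<eta>2) - lam * t)"
  have c: "0 < c" and W: "0 < W" using pos by (simp_all add: c_def W_def)
  obtain C \<delta> where C: "0 \<le> C" and \<delta>: "\<And>k. 0 \<le> \<delta> k \<and> \<delta> k \<le> C / real (k + 2)"
    and a: "\<And>k. a_coeff lam \<eta>1 \<eta>2 p q t k = W * c ^ Suc k / (fact k * fact (Suc k)) * (1 + \<delta> k)"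
    using a_coeff_estimate[OF pos] unfolding W_def c_def by blast
  define E where "E = 3 / (8 * sqrt c)"
  \<comment> \<open>The Laplace error \<open>e\<close> and the perturbation error \<open>f\<close>
    combine to \<open>(1 + e) * (1 + f) - 1 = e + (1 + e) * f\<close>. Both are multiples of
    \<open>1 / sqrt y\<close>, and \<open>e \<le> E\<close> for \<open>y \<ge> 1\<close>.\<close>
  define D where "D = E + (1 + E) * (C / sqrt c)"
  have "\<bar>(\<Sum>k. a_coeff lam \<eta>1 \<eta>2 p q t k * y ^ k) - main y\<bar> \<le> D * y powr (- 1 / 2) * main y"
    if y: "1 \<le> y" for y
  proof -
    define z where "z = c * y"
    have z: "0 < z" using c y by (simp add: z_def)
    let ?T = "\<lambda>k. z ^ k / (fact k * fact (Suc k)) * (1 + \<delta> k)"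
    \<comment> \<open>One factor \<open>c\<close> is left over from \<open>c ^ Suc k\<close>; with
      \<open>z powr (- 3 / 4)\<close> it yields the prefactor \<open>c powr (1 / 4)\<close>.\<close>
    have "c powr 1 * c powr (- 3 / 4) = c powr (1 / 4)"
      unfolding powr_add[symmetric] by simp
    then have main: "main y = W * c * bessel_main z"
      using c y unfolding main_def W_def[symmetric] c_def[symmetric] bessel_main_def z_def
      by (simp add: powr_mult real_sqrt_mult mult_ac)
    have bm: "0 < bessel_main z" by (rule bessel_main_pos[OF z])
    have "(\<lambda>k. a_coeff lam \<eta>1 \<eta>2 p q t k * y ^ k) = (\<lambda>k. W * c * ?T k)"
      unfolding a z_def by (simp add: power_mult_distrib mult_ac del: fact_Suc)
    then have S: "(\<Sum>k. a_coeff lam \<eta>1 \<eta>2 p q t k * y ^ k) = W * c * (\<Sum>k. ?T k)"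
      using suminf_mult[OF perturbed_bessel_series_bounds(3)[OF z C \<delta>]] by simp
    define e where "e = E / sqrt y"
    define f where "f = C / sqrt c / sqrt y"
    have ef: "0 \<le> e" "e \<le> E" "0 \<le> f"
      using y c C by (auto simp: e_def E_def f_def field_simps)
    have "\<bar>bessel_series z - bessel_main z\<bar> \<le> e * bessel_main z"
      using bessel_series_asymp[OF z] by (simp add: e_def E_def z_def real_sqrt_mult)
    then have bs: "bessel_main z - e * bessel_main z \<le> bessel_series z"
      "bessel_series z \<le> bessel_main z * (1 + e)"
      by (auto simp: abs_le_iff algebra_simps)
    have "(\<Sum>k. ?T k) \<le> bessel_series z * (1 + f)"
      using perturbed_bessel_series_bounds(2)[OF z C \<delta>] by (simp add: f_def z_def real_sqrt_mult)
    also have "\<dots> \<le> bessel_main z * (1 + e) * (1 + f)"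
      using bs ef by (intro mult_right_mono) auto
    also have "\<dots> = bessel_main z + (e + (1 + e) * f) * bessel_main z"
      by (simp add: algebra_simps)
    also have "\<dots> \<le> bessel_main z + (e + (1 + E) * f) * bessel_main z"
      using ef bm by (intro add_left_mono mult_right_mono add_mono) auto
    finally have upper: "(\<Sum>k. ?T k) \<le> bessel_main z + (e + (1 + E) * f) * bessel_main z" .
    have "0 \<le> (1 + E) * f" using ef by simp
    then have "e * bessel_main z \<le> (e + (1 + E) * f) * bessel_main z"
      using bm by (intro mult_right_mono) auto
    then have lower: "bessel_main z - (e + (1 + E) * f) * bessel_main z \<le> (\<Sum>k. ?T k)"
      using perturbed_bessel_series_bounds(1)[OF z C \<delta>] bs by linarith
    have "y powr (- 1 / 2) = 1 / sqrt y"
      using y powr_minus_divide[of y "1 / 2"] by (simp add: powr_half_sqrt)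
    then have D: "e + (1 + E) * f = D * y powr (- 1 / 2)"
      by (simp add: D_def e_def f_def add_divide_distrib)
    have "\<bar>(\<Sum>k. a_coeff lam \<eta>1 \<eta>2 p q t k * y ^ k) - main y\<bar> = W * c * \<bar>(\<Sum>k. ?T k) - bessel_main z\<bar>"
      unfolding S main right_diff_distrib[symmetric] using W c by (simp add: abs_mult)
    also have "\<dots> \<le> W * c * ((e + (1 + E) * f) * bessel_main z)"
      using W c upper lower by (intro mult_left_mono) (auto simp: abs_le_iff)
    also have "\<dots> = D * y powr (- 1 / 2) * main y"
      unfolding main D by (simp only: mult_ac)
    finally show ?thesis .
  qed
  then show ?thesis by blast
qed

text \<open>The witness \<open>h x / g x - 1\<close> is forced wherever \<open>g\<close> is
  positive; dividing the error bound by \<open>g x\<close> gives its order.\<close>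

lemma relative_error_bigo:
  fixes h g e :: "real \<Rightarrow> real"
  assumes "\<forall>\<^sub>F x in F. 0 < g x" and "\<forall>\<^sub>F x in F. 0 \<le> e x"
    and "\<forall>\<^sub>F x in F. \<bar>h x - g x\<bar> \<le> D * e x * g x"
  shows "\<exists>R. R \<in> O[F](e) \<and> (\<forall>\<^sub>F x in F. h x = g x * (1 + R x))"
proof (intro exI conjI)
  let ?R = "\<lambda>x. h x / g x - 1"
  show "?R \<in> O[F](e)"
  proof (rule bigoI[where c = D])
    show "\<forall>\<^sub>F x in F. norm (?R x) \<le> D * norm (e x)"
      using assms
    proof eventually_elim
      case (elim x)
      have "?R x = (h x - g x) / g x"
        using elim(1) by (simp add: diff_divide_distrib)
      then have "norm (?R x) = \<bar>h x - g x\<bar> / g x"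
        using elim(1) by simp
      then show ?case
        using elim by (simp add: divide_le_eq)
    qed
  qed
  show "\<forall>\<^sub>F x in F. h x = g x * (1 + ?R x)"
    using assms(1) by eventually_elim simp
qed

text \<open>Reflecting the jumps exchanges the two rates and the two probabilities. The sums agree
  term by term, without reindexing.\<close>

lemma b_coeff_eq_a_coeff: "b_coeff lam \<eta>1 \<eta>2 p q t = a_coeff lam \<eta>2 \<eta>1 q p t"
proof -
  have "Q_coeff \<eta>1 \<eta>2 p q n k = P_coeff \<eta>2 \<eta>1 q p n k" for n k
    unfolding P_coeff_def Q_coeff_def by (simp add: add.commute mult_ac)
  then show ?thesis
    unfolding a_coeff_def b_coeff_def by simp
qed

theorem corollary3:
  fixes lam \<eta>1 \<eta>2 p q t :: real
  assumes "lam > 0" and "\<eta>1 > 1" and "\<eta>2 > 0"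
    and "p > 0" and "q > 0" and "p + q = 1"
    and "t > 0"
  shows "(\<exists>R. R \<in> O[at_top](\<lambda>x. ln x powr (- 1 / 2)) \<and>
           (\<forall>\<^sub>F x in at_top.
              H lam \<eta>1 \<eta>2 p q t x =
                1 / (2 * sqrt pi) * (\<eta>1 * lam * t * p) powr (1 / 4)
                * exp (\<eta>2 * lam * t * q / (\<eta>1 + \<eta>2) - lam * t)
                * ln x powr (- 3 / 4)
                * exp (2 * sqrt (\<eta>1 * lam * t * p) * sqrt (ln x))
                * x powr (- \<eta>1 - 1) * (1 + R x))) \<and>
         (\<exists>R. R \<in> O[at_right 0](\<lambda>x. ln (1 / x) powr (- 1 / 2)) \<and>
           (\<forall>\<^sub>F x in at_right 0.
              H lam \<eta>1 \<eta>2 p q t x =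
                1 / (2 * sqrt pi) * (\<eta>2 * lam * t * q) powr (1 / 4)
                * exp (\<eta>1 * lam * t * p / (\<eta>1 + \<eta>2) - lam * t)
                * ln (1 / x) powr (- 3 / 4)
                * exp (2 * sqrt (\<eta>2 * lam * t * q) * sqrt (ln (1 / x)))
                * x powr (\<eta>2 - 1) * (1 + R x)))"
proof -
  have pos: "0 < lam" "0 < \<eta>1" "0 < \<eta>2" "0 < p" "0 < q" "0 < t" using assms by auto
  have ln_at_top_ge: "\<forall>\<^sub>F x::real in at_top. 1 \<le> ln x"
    using ln_at_top unfolding filterlim_at_top by blast
  have ln_at_0_ge: "\<forall>\<^sub>F x::real in at_right 0. 1 \<le> ln (1 / x)"
    using filterlim_inverse_at_top_right ln_at_top_ge
    unfolding filterlim_iff inverse_eq_divide by blast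
  let ?S1 = "\<lambda>y. \<Sum>k. a_coeff lam \<eta>1 \<eta>2 p q t k * y ^ k"
  let ?S2 = "\<lambda>y. \<Sum>k. a_coeff lam \<eta>2 \<eta>1 q p t k * y ^ k"
  let ?m1 = "\<lambda>y. 1 / (2 * sqrt pi) * (\<eta>1 * lam * t * p) powr (1 / 4)
    * exp (\<eta>2 * lam * t * q / (\<eta>1 + \<eta>2) - lam * t) * y powr (- 3 / 4)
    * exp (2 * sqrt (\<eta>1 * lam * t * p) * sqrt y)"
  let ?m2 = "\<lambda>y. 1 / (2 * sqrt pi) * (\<eta>2 * lam * t * q) powr (1 / 4)
    * exp (\<eta>1 * lam * t * p / (\<eta>1 + \<eta>2) - lam * t) * y powr (- 3 / 4)
    * exp (2 * sqrt (\<eta>2 * lam * t * q) * sqrt y)"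
  obtain D1 where D1: "\<forall>y\<ge>1. \<bar>?S1 y - ?m1 y\<bar> \<le> D1 * y powr (- 1 / 2) * ?m1 y"
    using a_coeff_series_asymp[OF pos] ..
  obtain D2 where D2: "\<forall>y\<ge>1. \<bar>?S2 y - ?m2 y\<bar> \<le> D2 * y powr (- 1 / 2) * ?m2 y"
    \<comment> \<open>The positivity facts are permuted to fit the exchanged parameters.\<close>
    using a_coeff_series_asymp[OF pos(1,3,2,5,4,6), unfolded add.commute[of \<eta>2 \<eta>1]] ..
  have m1_pos: "0 < ?m1 y" and m2_pos: "0 < ?m2 y" if "1 \<le> y" for y
    using pos that by simp_all
  \<comment> \<open>Multiplication by the power of \<open>x\<close> in \<open>H\<close> preserves
    relative errors.\<close>
  have scale: "\<bar>S * w - m * w\<bar> \<le> D * e * (m * w)"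
    if "\<bar>S - m\<bar> \<le> D * e * m" "0 \<le> w" for S m w D e :: real
    using mult_right_mono[OF that] by (simp add: abs_mult that(2) left_diff_distrib[symmetric] mult.assoc)
  have "\<exists>R. R \<in> O[at_top](\<lambda>x. ln x powr (- 1 / 2)) \<and> (\<forall>\<^sub>F x in at_top.
      H lam \<eta>1 \<eta>2 p q t x = ?m1 (ln x) * x powr (- \<eta>1 - 1) * (1 + R x))"
  proof (rule relative_error_bigo[where D = D1])
    show "\<forall>\<^sub>F x in at_top. 0 < ?m1 (ln x) * x powr (- \<eta>1 - 1)"
      using ln_at_top_ge eventually_gt_at_top[of 0]
    proof eventually_elim
      case (elim x)
      then show ?case by (intro mult_pos_pos[OF m1_pos]) auto
    qed
    show "\<forall>\<^sub>F x in at_top. \<bar>H lam \<eta>1 \<eta>2 p q t x - ?m1 (ln x) * x powr (- \<eta>1 - 1)\<bar>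
        \<le> D1 * ln x powr (- 1 / 2) * (?m1 (ln x) * x powr (- \<eta>1 - 1))"
      using ln_at_top_ge eventually_gt_at_top[of 1]
    proof eventually_elim
      case (elim x)
      then have "H lam \<eta>1 \<eta>2 p q t x = ?S1 (ln x) * x powr (- \<eta>1 - 1)"
        by (simp add: H_def H1_def)
      then show ?case
        using scale[OF D1[rule_format, OF elim(1)], of "x powr (- \<eta>1 - 1)"] by (simp only: powr_ge_zero)
    qed
  qed simp
  moreover have "\<exists>R. R \<in> O[at_right 0](\<lambda>x. ln (1 / x) powr (- 1 / 2)) \<and> (\<forall>\<^sub>F x in at_right 0.
      H lam \<eta>1 \<eta>2 p q t x = ?m2 (ln (1 / x)) * x powr (\<eta>2 - 1) * (1 + R x))"
  proof (rule relative_error_bigo[where D = D2])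
    show "\<forall>\<^sub>F x in at_right 0. 0 < ?m2 (ln (1 / x)) * x powr (\<eta>2 - 1)"
      using ln_at_0_ge eventually_at_right_less[of 0]
    proof eventually_elim
      case (elim x)
      then show ?case by (intro mult_pos_pos[OF m2_pos]) auto
    qed
    show "\<forall>\<^sub>F x in at_right 0. \<bar>H lam \<eta>1 \<eta>2 p q t x - ?m2 (ln (1 / x)) * x powr (\<eta>2 - 1)\<bar>
        \<le> D2 * ln (1 / x) powr (- 1 / 2) * (?m2 (ln (1 / x)) * x powr (\<eta>2 - 1))"
      using ln_at_0_ge eventually_at_right_real[OF zero_less_one]
    proof eventually_elim
      case (elim x)
      then have "H lam \<eta>1 \<eta>2 p q t x = ?S2 (ln (1 / x)) * x powr (\<eta>2 - 1)"
        by (simp add: H_def H2_def b_coeff_eq_a_coeff del: ln_div)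
      then show ?case
        using scale[OF D2[rule_format, OF elim(1)], of "x powr (\<eta>2 - 1)"] by (simp only: powr_ge_zero)
    qed
  qed simp
  ultimately show ?thesis by (rule conjI)
qed

end
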